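(* Let $\beta\in(0,\infty)$ and $\gamma\in(0,2\beta)$. The averagedness coefficient $\frac{2\beta}{4\beta-\gamma}$ of the Davis--Yin splitting operators is tight in the sense that it cannot be improved without further assumptions: for every $\theta'\in\left(0,\frac{2\beta}{4\beta-\gamma}\right)$ there exist a real Hilbert space $\mathcal{H}$, maximal monotone operators $A,B:\mathcal{H}\rightrightarrows\mathcal{H}$, and a $\beta$-cocoercive operator $C:\mathcal{H}\to\mathcal{H}$ such that $T_\gamma(A,B,C)$ is not $\theta'$-averaged.
   Context: Let $\mathcal{H}$ be a real Hilbert space with inner product $\langle\cdot,\cdot\rangle$ and norm $\|\cdot\|$, and let $I$ be the identity. A multi-valued operator $A:\mathcal{H}\rightrightarrows\mathcal{H}$ is monotone if $\langle u-v,x-y\rangle\ge0$ for all $x,y\in\mathcal{H}$, $u\in Ax$, $v\in Ay$, and maximal monotone if its graph is not properly contained in the graph of another monotone operator. The resolvent of $A$ is $J_A=(I+A)^{-1}$. For $\beta>0$, a single-valued $C:\mathcal{H}\to\mathcal{H}$ is $\beta$-cocoercive if $\langle Cx-Cy,x-y\rangle\ge\beta\|Cx-Cy\|^2$ for all $x,y\in\mathcal{H}$. For $\theta\in(0,1)$, an operator $T:\mathcal{H}\to\mathcal{H}$ is $\theta$-averaged if $T=(1-\theta)I+\theta N$ for some nonexpansive (1-Lipschitz) $N:\mathcal{H}\to\mathcal{H}$. The Davis--Yin splitting operator is $$T_\gamma(A,B,C)=I-J_{\gamma B}+J_{\gamma A}(2J_{\gamma B}-I-\gamma CJ_{\gamma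 B}).$$ It is a known result of Davis and Yin that for $\gamma\in(0,2\beta)$, $A,B$ maximal monotone and $C$ $\beta$-cocoercive, $T_\gamma(A,B,C)$ is $\frac{2\beta}{4\beta-\gamma}$-averaged. *)

theory Defs
  imports "HOL-Analysis.Analysis"
begin

text \<open>
  HOL cannot quantify over types inside a formula, so a Hilbert space over which one wants to
  quantify existentially is given by a linear subspace \<open>H\<close> of an ambient real vector space
  together with an inner product \<open>ip\<close> on \<open>H\<close> that makes \<open>H\<close> complete. The ambient type supplies
  only addition and scaling; any norm it may carry plays no role, and \<open>ip\<close> is unconstrained
  outside \<open>H\<close>.
\<close>

definition ip_norm :: "('v::real_vector \<Rightarrow> 'v \<Rightarrow> real) \<Rightarrow> 'v \<Rightarrow> real" where
  "ip_norm ip x = sqrt (ip x x)"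

definition ip_Cauchy :: "('v::real_vector \<Rightarrow> 'v \<Rightarrow> real) \<Rightarrow> (nat \<Rightarrow> 'v) \<Rightarrow> bool" where
  "ip_Cauchy ip X \<longleftrightarrow> (\<forall>e>0. \<exists>M. \<forall>m\<ge>M. \<forall>n\<ge>M. ip_norm ip (X m - X n) < e)"

locale real_hilbert_space =
  fixes H :: "'v::real_vector set" and ip :: "'v \<Rightarrow> 'v \<Rightarrow> real"
  assumes subspace: "subspace H"
    and commute: "\<lbrakk>x \<in> H; y \<in> H\<rbrakk> \<Longrightarrow> ip x y = ip y x"
    and add_left: "\<lbrakk>x \<in> H; y \<in> H; z \<in> H\<rbrakk> \<Longrightarrow> ip (x + y) z = ip x z + ip y z"
    and scaleR_left: "\<lbrakk>x \<in> H; y \<in> H\<rbrakk> \<Longrightarrow> ip (r *\<^sub>R x) y = r * ip x y"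
    and nonneg: "x \<in> H \<Longrightarrow> 0 \<le> ip x x"
    and eq_zero_iff: "x \<in> H \<Longrightarrow> ip x x = 0 \<longleftrightarrow> x = 0"
    and complete: "\<lbrakk>\<And>n. X n \<in> H; ip_Cauchy ip X\<rbrakk>
      \<Longrightarrow> \<exists>l\<in>H. (\<lambda>n. ip_norm ip (X n - l)) \<longlonglongrightarrow> 0"

lemma real_hilbert_space_UNIV:
  "real_hilbert_space (UNIV :: 'a::{real_inner, complete_space} set) inner"
proof
  fix X :: "nat \<Rightarrow> 'a"
  assume "ip_Cauchy inner X"
  then have "Cauchy X"
    by (simp add: ip_Cauchy_def ip_norm_def Cauchy_def dist_norm norm_eq_sqrt_inner)
  then obtain l where "X \<longlonglongrightarrow> l"
    using Cauchy_convergent convergent_def by blast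
  then have "(\<lambda>n. norm (X n - l)) \<longlonglongrightarrow> 0"
    by (simp add: LIM_zero_iff tendsto_norm_zero_iff)
  then show "\<exists>l\<in>UNIV. (\<lambda>n. ip_norm inner (X n - l)) \<longlonglongrightarrow> 0"
    by (auto simp: ip_norm_def norm_eq_sqrt_inner)
qed (rule subspace_UNIV inner_commute inner_add_left inner_scaleR_left inner_ge_zero inner_eq_zero_iff)+

text \<open>
  The ambient vector space used for the existential. It has Hamel dimension continuum, so every
  real Hilbert space of cardinality at most the continuum (in particular every separable one) is
  isometrically isomorphic to some \<open>(H, ip)\<close> over it.
\<close>

type_synonym ambient = "(nat, real) bcontfun"

text \<open>A multi-valued operator is identified with its graph.\<close>

type_synonym 'v mop = "('v \<times> 'v) set"

definition monotone_operator ::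
  "'v::real_vector set \<Rightarrow> ('v \<Rightarrow> 'v \<Rightarrow> real) \<Rightarrow> 'v mop \<Rightarrow> bool" where
  "monotone_operator H ip A \<longleftrightarrow>
     A \<subseteq> H \<times> H \<and> (\<forall>x u y v. (x, u) \<in> A \<longrightarrow> (y, v) \<in> A \<longrightarrow> 0 \<le> ip (u - v) (x - y))"

definition maximal_monotone ::
  "'v::real_vector set \<Rightarrow> ('v \<Rightarrow> 'v \<Rightarrow> real) \<Rightarrow> 'v mop \<Rightarrow> bool" where
  "maximal_monotone H ip A \<longleftrightarrow>
     monotone_operator H ip A \<and> \<not> (\<exists>A'. monotone_operator H ip A' \<and> A \<subset> A')"

definition cocoercive ::
  "'v::real_vector set \<Rightarrow> ('v \<Rightarrow> 'v \<Rightarrow> real) \<Rightarrow> real \<Rightarrow> ('v \<Rightarrow> 'v) \<Rightarrow> bool" where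
  "cocoercive H ip \<beta> C \<longleftrightarrow>
     C ` H \<subseteq> H \<and> (\<forall>x\<in>H. \<forall>y\<in>H. ip (C x - C y) (x - y) \<ge> \<beta> * (ip_norm ip (C x - C y))\<^sup>2)"

definition nonexpansive ::
  "'v::real_vector set \<Rightarrow> ('v \<Rightarrow> 'v \<Rightarrow> real) \<Rightarrow> ('v \<Rightarrow> 'v) \<Rightarrow> bool" where
  "nonexpansive H ip N \<longleftrightarrow>
     N ` H \<subseteq> H \<and> (\<forall>x\<in>H. \<forall>y\<in>H. ip_norm ip (N x - N y) \<le> ip_norm ip (x - y))"

definition averaged ::
  "'v::real_vector set \<Rightarrow> ('v \<Rightarrow> 'v \<Rightarrow> real) \<Rightarrow> real \<Rightarrow> ('v \<Rightarrow> 'v) \<Rightarrow> bool" where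
  "averaged H ip \<theta> T \<longleftrightarrow>
     (\<exists>N. nonexpansive H ip N \<and> (\<forall>x\<in>H. T x = (1 - \<theta>) *\<^sub>R x + \<theta> *\<^sub>R N x))"

definition scale_mop :: "real \<Rightarrow> 'v::real_vector mop \<Rightarrow> 'v mop" where
  "scale_mop c A = {(x, c *\<^sub>R u) | x u. (x, u) \<in> A}"

definition id_plus_mop :: "'v::real_vector mop \<Rightarrow> 'v mop" where
  "id_plus_mop A = {(x, x + u) | x u. (x, u) \<in> A}"

text \<open>
  The resolvent as a function. By Minty's theorem the relation \<open>(id_plus_mop A)\<inverse>\<close> is
  single-valued with full domain \<open>H\<close> for maximal monotone \<open>A\<close>, so the description operator is
  well defined at every point of \<open>H\<close> in that case.
\<close>

definition resolvent :: "'v::real_vector mop \<Rightarrow> 'v \<Rightarrow> 'v" where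
  "resolvent A x = (THE y. (x, y) \<in> (id_plus_mop A)\<inverse>)"

definition davis_yin ::
  "real \<Rightarrow> 'v::real_vector mop \<Rightarrow> 'v mop \<Rightarrow> ('v \<Rightarrow> 'v) \<Rightarrow> 'v \<Rightarrow> 'v" where
  "davis_yin \<gamma> A B C x =
     x - resolvent (scale_mop \<gamma> B) x
       + resolvent (scale_mop \<gamma> A)
           (2 *\<^sub>R resolvent (scale_mop \<gamma> B) x - x - \<gamma> *\<^sub>R C (resolvent (scale_mop \<gamma> B) x))"

end

theory Submission
  imports Defs
begin

text \<open>
  Write \<open>x\<^sub>B = J\<^bsub>\<gamma>B\<^esub> z\<close>, \<open>x\<^sub>A = J\<^bsub>\<gamma>A\<^esub> (2 x\<^sub>B - z - \<gamma> C x\<^sub>B)\<close> and \<open>d = x\<^sub>B - x\<^sub>A = z - T z\<close>. The proof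
  of Davis and Yin gives \<open>\<langle>d, z\<rangle> \<ge> (1 - \<gamma>/(4\<beta>)) \<parallel>d\<parallel>\<^sup>2\<close> (for linear operators), with equality iff
  both monotonicity inequalities and the cocoercivity inequality are equalities along the trajectory
  and \<open>C x\<^sub>B = d / (2\<beta>)\<close>. In the complex plane all of this is achieved at
  \<open>x\<^sub>B = (1 + \<i>)/2\<close>, \<open>x\<^sub>A = (-1 + \<i>)/2\<close>, \<open>d = 1\<close> by the skew operators
  \<open>\<gamma>A = \<gamma>B = -\<i>k\<close> with \<open>k = 1 - \<gamma>/(2\<beta>)\<close> and by \<open>C = Re / \<beta>\<close>.
\<close>

text \<open>Copies a Hilbert space onto the subspace \<open>range e\<close> of another vector space.
  The inner product is pulled back along the left inverse \<open>p\<close>, so claims about points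
  \<open>e w\<close> become claims about \<open>w\<close>, and completeness is inherited.\<close>

locale hilbert_embedding =
  fixes e :: "'a::{real_inner,complete_space} \<Rightarrow> 'v::real_vector" and p :: "'v \<Rightarrow> 'a"
  assumes linear_e: "linear e" and p_e [simp]: "p (e w) = w"
begin

definition ip :: "'v \<Rightarrow> 'v \<Rightarrow> real" where
  "ip x y = inner (p x) (p y)"

definition graph_op :: "('a \<Rightarrow> 'a) \<Rightarrow> 'v mop" where
  "graph_op L = {(e w, e (L w)) | w. True}"

lemma e_add: "e x + e y = e (x + y)"
  and e_diff: "e x - e y = e (x - y)"
  and e_scaleR: "r *\<^sub>R e x = e (r *\<^sub>R x)"
  using linear_e by (simp_all add: linear_add linear_diff linear_scale)

lemma e_zero: "e 0 = 0"
  using linear_e by (rule linear_0)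

lemma e_eq_iff [simp]: "e x = e y \<longleftrightarrow> x = y"
  by (metis p_e)

lemma ip_e [simp]: "ip (e x) (e y) = inner x y"
  by (simp add: ip_def)

lemma ip_norm_e [simp]: "ip_norm ip (e x) = norm x"
  by (simp add: ip_norm_def norm_eq_sqrt_inner)

lemma real_hilbert_space_range: "real_hilbert_space (range e) ip"
proof
  show "subspace (range e)"
    using linear_e by (simp add: linear_subspace_image)
  fix X :: "nat \<Rightarrow> 'v"
  assume X: "\<And>n. X n \<in> range e" and "ip_Cauchy ip X"
  define w where "w n = p (X n)" for n
  have Xw: "X n = e (w n)" for n
    using X[of n] by (auto simp: w_def)
  have "Cauchy w"
    using \<open>ip_Cauchy ip X\<close> by (simp add: ip_Cauchy_def Xw e_diff Cauchy_def dist_norm)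
  then obtain l where "w \<longlonglongrightarrow> l"
    using Cauchy_convergent convergent_def by blast
  then have "(\<lambda>n. norm (w n - l)) \<longlonglongrightarrow> 0"
    by (simp add: LIM_zero_iff tendsto_norm_zero_iff)
  then show "\<exists>l\<in>range e. (\<lambda>n. ip_norm ip (X n - l)) \<longlonglongrightarrow> 0"
    by (auto simp: Xw e_diff)
qed (auto simp: e_add e_scaleR inner_commute inner_add_left inner_add_right e_zero[symmetric])

lemma maximal_monotone_skew:
  assumes "linear L" and skew: "\<And>w. inner (L w) w = 0"
  shows "maximal_monotone (range e) ip (graph_op L)"
  unfolding maximal_monotone_def
proof
  have "inner (L x - L y) (x - y) = 0" for x y
    using skew[of "x - y"] \<open>linear L\<close> by (simp add: linear_diff)
  then show "monotone_operator (range e) ip (graph_op L)"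
    by (auto simp: monotone_operator_def graph_op_def e_diff)
  show "\<not> (\<exists>A'. monotone_operator (range e) ip A' \<and> graph_op L \<subset> A')"
  proof
    assume "\<exists>A'. monotone_operator (range e) ip A' \<and> graph_op L \<subset> A'"
    then obtain A' z where mono: "monotone_operator (range e) ip A'"
      and sub: "graph_op L \<subseteq> A'" and z: "z \<in> A'" "z \<notin> graph_op L"
      by blast
    from mono z obtain w v where zwv: "z = (e w, e v)"
      unfolding monotone_operator_def by blast
    define h where "h = L w - v"
    have v: "v = L w - h"
      by (simp add: h_def)
    \<comment> \<open>Testing the extra point of \<open>A'\<close> against the graph point over
      \<open>w - h\<close> turns the monotonicity inequality into 0 <= - inner h h, because L h is
      orthogonal to h.\<close>
    have "(e (w - h), e (L (w - h))) \<in> A'"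
      using sub by (auto simp: graph_op_def)
    then have "0 \<le> ip (e v - e (L (w - h))) (e w - e (w - h))"
      using mono z(1) zwv unfolding monotone_operator_def by blast
    also have "\<dots> = inner (L h - h) h"
      using \<open>linear L\<close> v by (simp add: e_diff linear_diff)
    also have "\<dots> = - inner h h"
      by (simp add: inner_diff_left skew)
    finally have "h = 0"
      by (metis inner_ge_zero inner_eq_zero_iff neg_0_le_iff_le order_antisym)
    then have "z \<in> graph_op L"
      by (auto simp: zwv graph_op_def h_def)
    with z(2) show False ..
  qed
qed

lemma scale_mop_graph_op: "scale_mop c (graph_op L) = graph_op (\<lambda>w. c *\<^sub>R L w)"
  by (auto simp: scale_mop_def graph_op_def e_scaleR)

text \<open>Writing the input as \<open>w + L w\<close> avoids inverting I + L. Uniqueness follows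
  by pairing the difference of two solutions with itself: skewness leaves only its squared
  norm.\<close>

lemma resolvent_skew:
  assumes "linear L" and skew: "\<And>w. inner (L w) w = 0"
  shows "resolvent (graph_op L) (e (w + L w)) = e w"
  unfolding resolvent_def
proof (rule the_equality)
  show "(e (w + L w), e w) \<in> (id_plus_mop (graph_op L))\<inverse>"
    by (auto simp: id_plus_mop_def graph_op_def e_add)
  fix y
  assume "(e (w + L w), y) \<in> (id_plus_mop (graph_op L))\<inverse>"
  then obtain v where y: "y = e v" and eq: "w + L w = v + L v"
    by (auto simp: id_plus_mop_def graph_op_def e_add)
  have "(w - v) + L (w - v) = 0"
    using eq \<open>linear L\<close> by (simp add: linear_diff algebra_simps)
  then have "inner (w - v) (w - v) + inner (L (w - v)) (w - v) = 0"
    by (metis inner_add_left inner_zero_left)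
  then show "y = e w"
    by (simp add: skew y)
qed

text \<open>The nonexpansive part \<open>N\<close> also fixes 0, so it does not increase the norm of
  z. Since \<theta> N z = \<theta> z - d, expanding the squares of both sides leaves this
  bound.\<close>

lemma averaged_fixing_zero:
  assumes "averaged (range e) ip \<theta> T" "T 0 = 0" "0 < \<theta>" "T (e z) = e (z - d)"
  shows "inner d d \<le> 2 * \<theta> * inner d z"
proof -
  obtain N where N: "nonexpansive (range e) ip N"
    and T: "\<And>x. x \<in> range e \<Longrightarrow> T x = (1 - \<theta>) *\<^sub>R x + \<theta> *\<^sub>R N x"
    using assms(1) unfolding averaged_def by blast
  have "N 0 = 0"
    using T[of 0] assms(2,3) by (metis add_0 e_zero less_irrefl rangeI scaleR_eq_0_iff scaleR_zero_right)
  obtain n where n: "N (e z) = e n"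
    using N unfolding nonexpansive_def by blast
  have "z - d = (1 - \<theta>) *\<^sub>R z + \<theta> *\<^sub>R n"
    using T[of "e z"] assms(4) by (simp add: n e_scaleR e_add)
  then have n_eq: "\<theta> *\<^sub>R n = \<theta> *\<^sub>R z - d"
    by (simp add: algebra_simps)
  have "ip_norm ip (N (e z) - N (e 0)) \<le> ip_norm ip (e z - e 0)"
    using N unfolding nonexpansive_def by blast
  then have "norm n \<le> norm z"
    using \<open>N 0 = 0\<close> by (simp add: n e_zero)
  then have "norm (\<theta> *\<^sub>R n) \<le> norm (\<theta> *\<^sub>R z)"
    using assms(3) by simp
  then have "inner (\<theta> *\<^sub>R z - d) (\<theta> *\<^sub>R z - d) \<le> inner (\<theta> *\<^sub>R z) (\<theta> *\<^sub>R z)"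
    by (simp only: n_eq norm_le)
  then show ?thesis
    by (simp add: inner_diff_left inner_diff_right inner_commute algebra_simps)
qed

end

text \<open>The sequence is constant from index 1 on, so its range is finite and boundedness is
  immediate.\<close>

definition embed_complex :: "complex \<Rightarrow> ambient" where
  "embed_complex w = Bcontfun (\<lambda>n. if n = 0 then Re w else Im w)"

lemma apply_embed_complex:
  "apply_bcontfun (embed_complex w) n = (if n = 0 then Re w else Im w)"
proof -
  have "(\<lambda>n::nat. if n = 0 then Re w else Im w) \<in> bcontfun"
    by (auto simp: bcontfun_def intro!: finite_imp_bounded
        intro: finite_subset[of _ "{Re w, Im w}"])
  then show ?thesis
    by (simp add: embed_complex_def Bcontfun_inverse)
qed

definition proj_complex :: "ambient \<Rightarrow> complex" where
  "proj_complex x = Complex (apply_bcontfun x 0) (apply_bcontfun x 1)"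

interpretation E: hilbert_embedding embed_complex proj_complex
proof (rule hilbert_embedding.intro)
  show "linear embed_complex"
    by (intro linearI bcontfun_eqI) (simp_all add: apply_embed_complex)
  show "proj_complex (embed_complex w) = w" for w
    by (simp add: proj_complex_def apply_embed_complex)
qed

theorem corollary2:
  fixes \<beta> \<gamma> \<theta>' :: real
  assumes "0 < \<beta>"
    and "0 < \<gamma>" "\<gamma> < 2 * \<beta>"
    and "0 < \<theta>'" "\<theta>' < 2 * \<beta> / (4 * \<beta> - \<gamma>)"
  shows "\<exists>(H :: ambient set) ip A B C.
           real_hilbert_space H ip \<and>
           maximal_monotone H ip A \<and> maximal_monotone H ip B \<and>
           cocoercive H ip \<beta> C \<and>
           \<not> averaged H ip \<theta>' (davis_yin \<gamma> A B C)"
proof -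
  define k where "k = 1 - \<gamma> / (2 * \<beta>)"
  define M where "M c w = c *\<^sub>R (- \<i> * w)" for c :: real and w
  define A where "A = E.graph_op (M (k / \<gamma>))"
  define C where "C x = embed_complex (of_real (Re (proj_complex x) / \<beta>))" for x
  define T where "T = davis_yin \<gamma> A A C"
  have linear_M: "linear (M c)" and skew_M: "inner (M c w) w = 0" for c w
    by (auto simp: M_def inner_complex_def algebra_simps intro!: linearI)
  have A: "maximal_monotone (range embed_complex) E.ip A"
    unfolding A_def by (rule E.maximal_monotone_skew[OF linear_M skew_M])
  have C: "cocoercive (range embed_complex) E.ip \<beta> C"
  proof -
    \<comment> \<open>Only real parts enter, and both sides equal (Re x - Re y)^2 / \<beta>.\<close>
    have "\<beta> * (norm (complex_of_real (Re x / \<beta>) - of_real (Re y / \<beta>)))\<^sup>2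
        = inner (of_real (Re x / \<beta>) - complex_of_real (Re y / \<beta>)) (x - y)" for x y
      using \<open>0 < \<beta>\<close>
      by (simp add: inner_complex_def cmod_power2) (simp add: power2_eq_square field_simps)
    then show ?thesis
      by (auto simp: cocoercive_def C_def E.e_diff)
  qed
  have "(\<lambda>w. \<gamma> *\<^sub>R M (k / \<gamma>) w) = M k"
    using \<open>0 < \<gamma>\<close> by (simp add: fun_eq_iff M_def)
  then have scale_A: "scale_mop \<gamma> A = E.graph_op (M k)"
    by (simp add: A_def E.scale_mop_graph_op)
  \<comment> \<open>Here \<open>w\<close> is x_B and \<open>v\<close> is x_A. Both resolvent values
    are prescribed, and the condition says that \<open>v\<close> fits the input of the second
    resolvent.\<close>
  have T: "T (embed_complex (w + M k w)) = embed_complex (w + M k w - (w - v))"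
    if "w - M k w - of_real (\<gamma> * Re w / \<beta>) = v + M k v" for w v
  proof -
    have J: "resolvent (scale_mop \<gamma> A) (embed_complex (u + M k u)) = embed_complex u" for u
      unfolding scale_A by (rule E.resolvent_skew[OF linear_M skew_M])
    have "2 *\<^sub>R w - (w + M k w) - \<gamma> *\<^sub>R complex_of_real (Re w / \<beta>) = v + M k v"
      unfolding that[symmetric] by (simp add: scaleR_2 scaleR_conv_of_real)
    then show ?thesis
      by (simp only: T_def davis_yin_def J C_def E.p_e E.e_scaleR E.e_diff E.e_add)
        (simp add: algebra_simps)
  qed
  define w where "w = Complex (1/2) (1/2)"
  define z where "z = w + M k w"
  \<comment> \<open>The choice of x_B and x_A gives d = 1; the value of \<open>k\<close> makes the
    condition on \<open>v\<close> hold.\<close>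
  have "T (embed_complex z) = embed_complex (z - 1)"
    using T[of w "Complex (-1/2) (1/2)"] \<open>0 < \<beta>\<close>
    by (simp add: z_def w_def M_def k_def complex_eq_iff field_simps)
  moreover have "T 0 = 0"
    using T[of 0 0] by (simp add: M_def E.e_zero)
  ultimately have "averaged (range embed_complex) E.ip \<theta>' T \<Longrightarrow> inner 1 (1::complex) \<le> 2 * \<theta>' * inner 1 z"
    using E.averaged_fixing_zero \<open>0 < \<theta>'\<close> by blast
  \<comment> \<open>Re z = (1 + k)/2 = (4 \<beta> - \<gamma>)/(4 \<beta>), so this is exactly the
    assumed upper bound on \<theta>'.\<close>
  moreover have "2 * \<theta>' * inner 1 z < inner 1 (1::complex)"
    using assms by (simp add: z_def w_def M_def k_def inner_complex_def field_simps)
  ultimately show ?thesis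
    using E.real_hilbert_space_range A C unfolding T_def by (meson not_le)
qed

end
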